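(* Let $H$ be a real Hilbert space, let $L>0$, and let $M\colon H\to H$ be a monotone and $L$-Lipschitz continuous operator with $\operatorname{zer} M:=\{x\in H \mid M(x)=0\}\neq\emptyset$. Let $\theta\in\big(0,\frac1L\big)$ and let $(\varepsilon^k)_{k\ge 0}$ be a sequence of positive real numbers such that $$\lim_{k\to+\infty}\varepsilon^k=0,\qquad \sum_{k=0}^{+\infty}\varepsilon^k=+\infty,\qquad \lim_{k\to+\infty}\frac{|\varepsilon^{k+1}-\varepsilon^k|}{\varepsilon^k}=0 .$$ Let $x^0\in H$ and let $(x^k)_{k\ge0}$, $(y^{k+1})_{k\ge0}$ be generated, for all $k\ge 0$, by $$\begin{cases} y^{k+1}=x^k-\theta\varepsilon^k x^k-\theta M(x^k),\\ x^{k+1}=x^k-\theta\varepsilon^{k+1}x^{k+1}-\theta M(y^{k+1}).\end{cases}$$ Then $(x^k)_k$ converges strongly, as $k\to+\infty$, to the minimum norm element of $\operatorname{zer} M$. Moreover, setting $\psi^k:=\frac12\|M(x^k)+\varepsilon^k x^k\|^2$ for all $k\ge0$, the following holds: for any $\delta\in(0,1)$ there exist $\widetilde C_\delta\ge 0$ and $k_0\ge 0$ such that $$\psi^{k+1}\le \frac{\psi^{k_0}}{\gamma^k}+\frac{\widetilde C_\delta}{\gamma^k}\sum_{j=k_0}^{k}\gamma^j\varepsilon^j\left(\frac{\varepsilon^{j+1}-\varepsilon^j}{\theta\varepsilon^j}\right)^2\qquad\text{for all } k\ge k_0,$$ where $\gamma^k:=\prod_{l=k_0}^{k}\big(1-2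(1-\delta)\theta\varepsilon^l\big)^{-1}$.
   Context: Superscripts $k$ on $x^k,y^k,\varepsilon^k,\psi^k,\gamma^k$ are indices, not powers. $M$ monotone means $\langle M(x)-M(x'),x-x'\rangle\ge0$ for all $x,x'\in H$. $L$-Lipschitz means $\|M(x)-M(x')\|\le L\|x-x'\|$ for all $x,x'\in H$. The second update is explicit: $x^{k+1}=(1+\theta\varepsilon^{k+1})^{-1}\big(x^k-\theta M(y^{k+1})\big)$. *)

theory Defs
  imports "HOL-Analysis.Analysis"
begin

definition monotone_operator :: "('a::real_inner \<Rightarrow> 'a) \<Rightarrow> bool" where
  "monotone_operator M \<longleftrightarrow> (\<forall>x x'. inner (M x - M x') (x - x') \<ge> 0)"

definition zer :: "('a \<Rightarrow> 'a::zero) \<Rightarrow> 'a set" where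
  "zer M = {x. M x = 0}"

definition is_min_norm_element :: "'a::real_normed_vector set \<Rightarrow> 'a \<Rightarrow> bool" where
  "is_min_norm_element S z \<longleftrightarrow> z \<in> S \<and> (\<forall>w\<in>S. norm z \<le> norm w)"

(* Arbitrary unless S has exactly one element of minimum norm. *)
definition min_norm_element :: "'a::real_normed_vector set \<Rightarrow> 'a" where
  "min_norm_element S = (THE z. is_min_norm_element S z)"

definition psi ::
    "('a::real_normed_vector \<Rightarrow> 'a) \<Rightarrow> (nat \<Rightarrow> real) \<Rightarrow> (nat \<Rightarrow> 'a) \<Rightarrow> nat \<Rightarrow> real" where
  "psi M \<epsilon> x k = 1 / 2 * (norm (M (x k) + \<epsilon> k *\<^sub>R x k))\<^sup>2"

definition gamma_factor :: "real \<Rightarrow> real \<Rightarrow> (nat \<Rightarrow> real) \<Rightarrow> nat \<Rightarrow> real" where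
  "gamma_factor \<delta> \<theta> \<epsilon> l = 1 - 2 * (1 - \<delta>) * \<theta> * \<epsilon> l"

(* A vanishing factor would be silently inverted to 0; a statement using gamma_seq has to
   require that the factors are nonzero from index k0 on. *)
definition gamma_seq :: "real \<Rightarrow> real \<Rightarrow> (nat \<Rightarrow> real) \<Rightarrow> nat \<Rightarrow> nat \<Rightarrow> real" where
  "gamma_seq \<delta> \<theta> \<epsilon> k0 k = (\<Prod>l=k0..k. inverse (gamma_factor \<delta> \<theta> \<epsilon> l))"

end

theory Submission
  imports Defs
begin

text \<open>
  Write \<open>u\<^sub>k = M x\<^sub>k + \<epsilon>\<^sub>k x\<^sub>k\<close> for the residual of the regularised equation, so that
  \<open>psi\<close> is half its squared norm, and \<open>v\<^sub>k\<close> for the direction actually used,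
  \<open>x\<^sub>k\<^sub>+\<^sub>1 = x\<^sub>k - \<theta> v\<^sub>k\<close>.

  The limit point comes from the Tikhonov regularisation \<open>M z + d z = 0\<close>. Its solution is
  unique for each \<open>d > 0\<close>, its norm can only grow as \<open>d\<close> decreases while staying below the norm of
  every zero of \<open>M\<close>, and distances between solutions are controlled by differences of squared
  norms. Hence the solutions converge strongly as \<open>d\<close> tends to 0, with no appeal to weak
  compactness (\<open>tikhonov_points_converge\<close>). The limit \<open>z\<close> is a zero, and testing monotonicity
  against the regularised solutions shows that \<open>\<langle>z, x\<^sub>k - z\<rangle>\<close> has nonnegative lower limit along
  every bounded sequence with \<open>M x\<^sub>k\<close> tending to 0
  (\<open>asymptotic_variational_inequality\<close>). For constant sequences this is the variational
  inequality that makes \<open>z\<close> the only zero of minimal norm.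

  Two one-step estimates govern the iteration. The first (\<open>energy_step\<close>) is an extragradient
  estimate: the distance to a zero decreases up to the regularisation terms, because
  \<open>\<theta> L < 1\<close> lets the error of replacing \<open>M x\<close> by \<open>M y\<close> be absorbed. It makes the iterates
  bounded. The second (\<open>residual_step\<close>, \<open>residual_contraction\<close>) says that \<open>psi\<close> contracts by
  \<open>1 - 2 (1 - \<delta>) \<theta> \<epsilon>\<^sub>k\<close> up to an error caused by the change of \<open>\<epsilon>\<close>; for bounded iterates this
  error is of the form \<open>C \<epsilon>\<^sub>k ((\<epsilon>\<^sub>k\<^sub>+\<^sub>1 - \<epsilon>\<^sub>k) / (\<theta> \<epsilon>\<^sub>k))\<^sup>2\<close>. Unrolling this recursion is the claimed rate.

  Since \<open>\<epsilon>\<close> is not summable, a recursion that contracts by a factor \<open>1 - c \<epsilon>\<^sub>k\<close> with an error of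
  order \<open>o(\<epsilon>\<^sub>k)\<close> forces convergence to 0 (\<open>vanishing_recursion\<close>). Applied to \<open>psi\<close> this gives
  \<open>M x\<^sub>k\<close> tending to 0. The asymptotic variational inequality then bounds the cross term in
  the energy estimate for the zero \<open>z\<close>, and the same recursion principle applied to the squared
  distance to \<open>z\<close> gives strong convergence. Working with the fixed point \<open>z\<close>, instead of
  following the moving regularised solutions, is what makes the hypothesis on
  \<open>\<bar>\<epsilon>\<^sub>k\<^sub>+\<^sub>1 - \<epsilon>\<^sub>k\<bar> / \<epsilon>\<^sub>k\<close> sufficient: tracking the moving solutions would ask for the quotient by
  \<open>\<epsilon>\<^sub>k\<^sup>2\<close> to vanish.
\<close>

section \<open>Real recursions\<close>

text \<open>
  As long as \<open>a\<close> stays above \<open>2 q\<close> and the error \<open>s\<close> below \<open>q\<close>, each step lowers \<open>a\<close> by at least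
  \<open>q b\<^sub>k\<close>; a nonnegative sequence cannot do this forever when \<open>b\<close> is not summable. Once below
  \<open>2 q\<close>, the sequence is trapped there, because a step takes a convex combination of \<open>a\<^sub>k\<close>
  and \<open>s\<^sub>k\<close>. The error is controlled from above because in the energy estimate
  it contains an inner product that need not tend to 0 from below.
\<close>

lemma vanishing_recursion:
  fixes a b s :: "nat \<Rightarrow> real"
  assumes nonneg: "\<And>k. 0 \<le> a k"
    and b: "\<forall>\<^sub>F k in sequentially. 0 \<le> b k \<and> b k \<le> 1"
    and diverges: "\<not> summable b"
    and s: "\<And>r. r > 0 \<Longrightarrow> \<forall>\<^sub>F k in sequentially. s k \<le> r"
    and rec: "\<forall>\<^sub>F k in sequentially. a (Suc k) \<le> (1 - b k) * a k + b k * s k"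
  shows "a \<longlonglongrightarrow> 0"
proof (rule LIMSEQ_I)
  fix r :: real assume "r > 0"
  define q where "q = r / 3"
  have q: "q > 0" using \<open>r > 0\<close> by (simp add: q_def)
  have "\<forall>\<^sub>F k in sequentially. (0 \<le> b k \<and> b k \<le> 1)
      \<and> a (Suc k) \<le> (1 - b k) * a k + b k * q"
    using b rec s[OF q]
  proof eventually_elim
    case (elim k)
    then have "b k * s k \<le> b k * q" by (intro mult_left_mono) auto
    with elim show ?case by linarith
  qed
  then obtain N where N: "\<And>k. k \<ge> N \<Longrightarrow> 0 \<le> b k \<and> b k \<le> 1"
      "\<And>k. k \<ge> N \<Longrightarrow> a (Suc k) \<le> (1 - b k) * a k + b k * q"
    unfolding eventually_sequentially by blast
  have "\<exists>m\<ge>N. a m \<le> 2 * q"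
  proof (rule ccontr)
    assume "\<not> (\<exists>m\<ge>N. a m \<le> 2 * q)"
    then have large: "a m > 2 * q" if "m \<ge> N" for m using that by force
    have drop: "q * b m \<le> a m - a (Suc m)" if "m \<ge> N" for m
    proof -
      have "b m * (2 * q) \<le> b m * a m"
        using N(1)[OF that] large[OF that] by (intro mult_left_mono) auto
      with N(2)[OF that] show ?thesis by (simp add: algebra_simps)
    qed
    have "(\<Sum>j<n. q * b (j + N)) \<le> a N - a (n + N)" for n
    proof (induction n)
      case (Suc n)
      then show ?case using drop[of "n + N"] by simp
    qed simp
    then have "(\<Sum>j<n. q * b (j + N)) \<le> a N" for n
      using nonneg[of "n + N"] by (smt (verit))
    then have "summable (\<lambda>j. q * b (j + N))"
      using N(1) q by (intro summableI_nonneg_bounded) auto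
    then have "summable (\<lambda>j. b (j + N))" using q by (simp add: summable_cmult_iff)
    with diverges show False by (simp add: summable_iff_shift)
  qed
  then obtain m where m: "m \<ge> N" "a m \<le> 2 * q" by blast
  have "a n \<le> 2 * q" if "n \<ge> m" for n
    using that
  proof (induction n rule: dec_induct)
    case base then show ?case by (fact m)
  next
    case (step n)
    have bn: "0 \<le> b n" "b n \<le> 1" using N(1)[of n] step m by auto
    have "(1 - b n) * a n \<le> (1 - b n) * (2 * q)"
      using bn step by (intro mult_left_mono) auto
    moreover have "b n * q \<le> b n * (2 * q)" using bn q by (intro mult_left_mono) auto
    ultimately show ?case using N(2)[of n] step m by (simp add: algebra_simps)
  qed
  moreover have "2 * q < r" using \<open>r > 0\<close> by (simp add: q_def)
  ultimately show "\<exists>n0. \<forall>n\<ge>n0. norm (a n - 0) < r"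
    using nonneg by (intro exI[of _ m]) (force simp: abs_of_nonneg)
qed

lemma linear_recursion_unrolled:
  fixes p g r :: "nat \<Rightarrow> real"
  assumes g: "\<And>l. l \<ge> k0 \<Longrightarrow> g l > 0"
    and rec: "\<And>k. k \<ge> k0 \<Longrightarrow> p (Suc k) \<le> g k * p k + r k"
    and "k \<ge> k0"
  shows "(\<Prod>l=k0..k. inverse (g l)) * p (Suc k)
    \<le> p k0 + (\<Sum>j=k0..k. (\<Prod>l=k0..j. inverse (g l)) * r j)"
  using \<open>k \<ge> k0\<close>
proof (induction k rule: dec_induct)
  case base
  show ?case using rec[of k0] g[of k0] by (simp add: field_simps)
next
  case (step n)
  define G where "G k = (\<Prod>l=k0..k. inverse (g l))" for k
  have G: "G (Suc n) = G n * inverse (g (Suc n))"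
    using step by (simp add: G_def prod.nat_ivl_Suc')
  have gpos: "g (Suc n) > 0" using g step by simp
  have "G (Suc n) > 0" unfolding G_def using g by (intro prod_pos) auto
  then have "G (Suc n) * p (Suc (Suc n)) \<le> G (Suc n) * (g (Suc n) * p (Suc n) + r (Suc n))"
    using rec[of "Suc n"] step by (intro mult_left_mono) auto
  also have "\<dots> = G n * p (Suc n) + G (Suc n) * r (Suc n)"
    using gpos by (simp add: G algebra_simps)
  finally show ?case using step.IH step.hyps by (simp add: G_def)
qed

section \<open>Tikhonov regularisation\<close>

text \<open>
  The regularised operator \<open>M + e\<close> is strongly monotone and Lipschitz, so a short explicit
  step along it is a contraction. This replaces the general surjectivity theorem for maximal
  monotone operators.
\<close>

lemma tikhonov_point_exists:
  fixes M :: "'a::{real_inner, complete_space} \<Rightarrow> 'a"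
  assumes mono: "monotone_operator M" and lip: "L-lipschitz_on UNIV M" and e: "e > 0"
  shows "\<exists>z. M z + e *\<^sub>R z = 0"
proof -
  have L: "L \<ge> 0" using lip by (rule lipschitz_on_nonneg)
  define K where "K = L + e"
  have K: "K > 0" "K \<ge> e" using L e by (auto simp: K_def)
  \<comment> \<open>this step length minimises the squared contraction factor \<open>1 - 2 t e + t\<^sup>2 K\<^sup>2\<close>\<close>
  define t where "t = e / K\<^sup>2"
  have t: "t > 0" using e K by (simp add: t_def)
  define T where "T z = z - t *\<^sub>R (M z + e *\<^sub>R z)" for z
  define c where "c = sqrt (1 - (e / K)\<^sup>2)"
  have eK: "0 < e / K" "e / K \<le> 1" using e K by auto
  then have eK2: "0 < (e / K)\<^sup>2" "(e / K)\<^sup>2 \<le> 1" by (auto simp: power_le_one)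
  then have c: "0 \<le> c" "c < 1" by (auto simp: c_def)
  have "dist (T z) (T w) \<le> c * dist z w" for z w
  proof -
    define d where "d = z - w"
    define f where "f = M z - M w + e *\<^sub>R d"
    have "norm (M z - M w) \<le> L * norm d"
      using lipschitz_onD[OF lip, of z w] by (simp add: dist_norm d_def)
    then have "norm f \<le> K * norm d"
      unfolding f_def K_def using norm_triangle_ineq[of "M z - M w" "e *\<^sub>R d"] e
      by (simp add: algebra_simps)
    then have f: "(norm f)\<^sup>2 \<le> K\<^sup>2 * (norm d)\<^sup>2"
      by (metis norm_ge_zero power_mono power_mult_distrib)
    have "inner f d \<ge> e * (norm d)\<^sup>2"
      using mono[unfolded monotone_operator_def, rule_format, of z w]
      by (simp add: f_def d_def inner_add_left power2_norm_eq_inner)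
    then have fd: "t * (e * (norm d)\<^sup>2) \<le> t * inner f d" using t by simp
    have "(norm (T z - T w))\<^sup>2 = (norm (d - t *\<^sub>R f))\<^sup>2"
      by (simp add: T_def d_def f_def algebra_simps)
    also have "\<dots> = (norm d)\<^sup>2 - 2 * (t * inner f d) + t\<^sup>2 * (norm f)\<^sup>2"
      unfolding power2_norm_eq_inner
      by (simp add: inner_diff_left inner_diff_right inner_commute power2_eq_square)
    also have "\<dots> \<le> (norm d)\<^sup>2 - 2 * (t * (e * (norm d)\<^sup>2)) + t\<^sup>2 * (K\<^sup>2 * (norm d)\<^sup>2)"
      using fd mult_left_mono[OF f, of "t\<^sup>2"] by simp
    also have "\<dots> = (1 - (e / K)\<^sup>2) * (norm d)\<^sup>2"
      using K by (simp add: t_def power2_eq_square field_simps)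
    also have "\<dots> = (c * norm d)\<^sup>2"
      using eK2 by (simp add: c_def power_mult_distrib)
    finally have "(norm (T z - T w))\<^sup>2 \<le> (c * norm d)\<^sup>2" .
    then have "norm (T z - T w) \<le> c * norm d"
      by (rule power2_le_imp_le) (simp add: c)
    then show ?thesis by (simp add: dist_norm d_def)
  qed
  then obtain z where "T z = z"
    using banach_fix_type[OF c, of T] by blast
  then show ?thesis using t by (auto simp: T_def)
qed

text \<open>
  Monotonicity at the two solutions gives \<open>\<langle>u, v - u\<rangle> \<ge> 0\<close> for the less regularised
  solution \<open>v\<close>, and this is the stated inequality after expanding \<open>\<parallel>v\<parallel>\<^sup>2\<close>. It turns
  convergence of the norms into strong convergence.
\<close>

lemma tikhonov_points_dist:
  fixes M :: "'a::real_inner \<Rightarrow> 'a"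
  assumes mono: "monotone_operator M"
    and d: "M u + d *\<^sub>R u = 0" and e: "M v + e *\<^sub>R v = 0" and "0 < e" "e \<le> d"
  shows "(norm (v - u))\<^sup>2 \<le> (norm v)\<^sup>2 - (norm u)\<^sup>2"
proof -
  have M: "M u = - d *\<^sub>R u" "M v = - e *\<^sub>R v"
    using d e by (simp_all add: eq_neg_iff_add_eq_0)
  have m: "inner (e *\<^sub>R v - d *\<^sub>R u) (v - u) \<le> 0"
    using mono[unfolded monotone_operator_def, rule_format, of u v]
    by (simp add: M inner_diff_left inner_diff_right algebra_simps inner_commute)
  have "e * (norm (v - u))\<^sup>2 = inner (e *\<^sub>R v - d *\<^sub>R u) (v - u) + (d - e) * inner u (v - u)"
    unfolding power2_norm_eq_inner by (simp add: algebra_simps inner_diff_left)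
  then have k: "e * (norm (v - u))\<^sup>2 \<le> (d - e) * inner u (v - u)" using m by linarith
  have uv: "inner u (v - u) \<ge> 0"
  proof (cases "d = e")
    case True
    then have "v = u" using k \<open>0 < e\<close> by (simp add: mult_le_0_iff)
    then show ?thesis by simp
  next
    case False
    have "0 \<le> (d - e) * inner u (v - u)" using k \<open>0 < e\<close>
      by (meson mult_nonneg_nonneg order_less_imp_le order_trans zero_le_power2)
    then show ?thesis using False \<open>e \<le> d\<close> by (simp add: zero_le_mult_iff)
  qed
  have "(norm v)\<^sup>2 - (norm u)\<^sup>2 = (norm (v - u))\<^sup>2 + 2 * inner u (v - u)"
    unfolding power2_norm_eq_inner by (simp add: inner_diff_left inner_diff_right inner_commute)
  with uv show ?thesis by simp
qed

lemma tikhonov_point_norm_le: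
  fixes M :: "'a::real_inner \<Rightarrow> 'a"
  assumes mono: "monotone_operator M" and z: "M z + e *\<^sub>R z = 0" "e > 0" and w: "M w = 0"
  shows "norm z \<le> norm w"
proof -
  have M: "M z = - e *\<^sub>R z" using z by (simp add: eq_neg_iff_add_eq_0)
  have "e * inner z (z - w) \<le> 0"
    using mono[unfolded monotone_operator_def, rule_format, of z w] by (simp add: M w)
  then have "inner z z \<le> inner z w" using z by (simp add: mult_le_0_iff inner_diff_right)
  also have "\<dots> \<le> norm z * norm w" by (rule norm_cauchy_schwarz)
  finally show ?thesis
    by (metis mult_le_cancel_left_pos norm_ge_zero norm_zero not_less_iff_gr_or_eq
        order_le_less power2_eq_square power2_norm_eq_inner)
qed

text \<open>
  The squared norms of the solutions are nondecreasing and are bounded by that of any zero, hence are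
  Cauchy; by the previous distance estimate so are the solutions themselves.
\<close>

lemma tikhonov_points_converge:
  fixes M :: "'a::{real_inner, complete_space} \<Rightarrow> 'a"
  assumes mono: "monotone_operator M" and lip: "L-lipschitz_on UNIV M" and ne: "zer M \<noteq> {}"
  obtains d z z' where "\<And>n. d n > 0" "\<And>n. M (z n) + d n *\<^sub>R z n = 0"
    "z \<longlonglongrightarrow> z'" "M z' = 0"
proof -
  define d :: "nat \<Rightarrow> real" where "d n = 1 / real (Suc n)" for n
  have d: "d n > 0" for n by (simp add: d_def)
  have d_anti: "d n \<le> d m" if "m \<le> n" for m n
    using that by (simp add: d_def frac_le)
  obtain z where z: "\<And>n. M (z n) + d n *\<^sub>R z n = 0"
    using tikhonov_point_exists[OF mono lip d] by metis
  obtain w where w: "M w = 0" using ne by (auto simp: zer_def)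
  define N where "N n = (norm (z n))\<^sup>2" for n
  have gap: "(norm (z n - z m))\<^sup>2 \<le> N n - N m" if "m \<le> n" for m n
    using tikhonov_points_dist[OF mono z z d d_anti[OF that]] by (simp add: N_def)
  have "incseq N"
    using gap by (intro monoI) (smt (verit) zero_le_power2)
  moreover have norm_z: "norm (z n) \<le> norm w" for n
    by (rule tikhonov_point_norm_le[OF mono z d w])
  then have "N n \<le> (norm w)\<^sup>2" for n by (simp add: N_def power_mono)
  ultimately have "Cauchy N"
    by (metis incseq_convergent convergentI convergent_Cauchy)
  have "Cauchy z"
  proof (rule CauchyI')
    fix r :: real assume "r > 0"
    then obtain K where K: "\<And>m n. m \<ge> K \<Longrightarrow> n \<ge> K \<Longrightarrow> norm (N m - N n) < r\<^sup>2"
      using CauchyD[OF \<open>Cauchy N\<close>, of "r\<^sup>2"] by auto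
    have "dist (z m) (z n) < r" if "m \<ge> K" "m < n" for m n
    proof -
      have "(norm (z n - z m))\<^sup>2 < r\<^sup>2"
        using gap[of m n] K[of n m] that by auto
      then show ?thesis
        using \<open>r > 0\<close> by (simp add: dist_norm norm_minus_commute power_less_imp_less_base)
    qed
    then show "\<exists>K. \<forall>m\<ge>K. \<forall>n>m. dist (z m) (z n) < r" by blast
  qed
  then obtain z' where z': "z \<longlonglongrightarrow> z'"
    using Cauchy_convergent convergent_def by blast
  have "isCont M z'"
    using lipschitz_on_continuous_on[OF lip] by (simp add: continuous_on_eq_continuous_at)
  then have lim1: "(\<lambda>n. M (z n)) \<longlonglongrightarrow> M z'" using z' by (rule isCont_tendsto_compose)
  have "d \<longlonglongrightarrow> 0"
    unfolding d_def using lim_1_over_n[THEN LIMSEQ_Suc] by simp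
  then have "(\<lambda>n. - (d n *\<^sub>R z n)) \<longlonglongrightarrow> - (0 *\<^sub>R z')"
    by (intro tendsto_intros z')
  moreover have "- (d n *\<^sub>R z n) = M (z n)" for n
    using z[of n] by (simp add: eq_neg_iff_add_eq_0 [symmetric])
  ultimately have "(\<lambda>n. M (z n)) \<longlonglongrightarrow> 0" by simp
  then have "M z' = 0" using lim1 LIMSEQ_unique by blast
  with d z z' show ?thesis by (rule that)
qed

text \<open>
  Monotonicity between \<open>x\<^sub>k\<close> and the regularised solution \<open>z\<^sub>n\<close>, where \<open>M z\<^sub>n = - d\<^sub>n z\<^sub>n\<close>, reads
  \<open>- d\<^sub>n \<langle>z\<^sub>n, x\<^sub>k - z\<^sub>n\<rangle> \<le> \<langle>M x\<^sub>k, x\<^sub>k - z\<^sub>n\<rangle>\<close>. For fixed \<open>n\<close> the right-hand side vanishes as \<open>k\<close>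
  grows, so one first fixes \<open>n\<close> with \<open>z\<^sub>n\<close> close to the limit and then lets \<open>k\<close> grow. This does
  the work usually done by weak cluster points of \<open>x\<close> and demiclosedness of \<open>M\<close>.
\<close>

lemma asymptotic_variational_inequality:
  fixes M :: "'a::real_inner \<Rightarrow> 'a"
  assumes mono: "monotone_operator M"
    and d: "\<And>n. d n > 0" and z: "\<And>n. M (z n) + d n *\<^sub>R z n = 0" and lim: "z \<longlonglongrightarrow> z'"
    and bdd: "\<And>k. norm (x k) \<le> R" and Mx: "(\<lambda>k. M (x k)) \<longlonglongrightarrow> 0" and "r > 0"
  shows "\<forall>\<^sub>F k in sequentially. - inner z' (x k - z') \<le> r"
proof -
  obtain B where B: "\<And>n. norm (z n) \<le> B"
    using convergent_imp_Bseq[of z] lim unfolding convergent_def Bseq_def by blast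
  have B0: "B \<ge> 0" "R \<ge> 0" using B[of 0] bdd[of 0] norm_ge_zero order_trans by blast+
  have "norm z' \<le> B"
    using B by (intro LIMSEQ_le_const2[OF tendsto_norm[OF lim]]) blast
  \<comment> \<open>replacing \<open>z n\<close> by \<open>z'\<close> costs at most \<open>(R + 2 B) \<parallel>z n - z'\<parallel>\<close>; the 1 keeps the denominator positive\<close>
  define q where "q = r / (4 * (R + 2 * B + 1))"
  have q: "q > 0" "(R + 2 * B) * q \<le> r / 4" using \<open>r > 0\<close> B0
    by (auto simp: q_def field_simps add_pos_nonneg)
  have "\<forall>\<^sub>F n in sequentially. norm (z n - z') < q"
    using tendstoD[OF lim q(1)] by (simp add: dist_norm)
  then obtain n where n: "norm (z n - z') < q"
    using eventually_happens'[OF sequentially_bot] by blast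
  have "(\<lambda>k. norm (M (x k)) * (R + B)) \<longlonglongrightarrow> 0"
    using tendsto_mult_left_zero[OF tendsto_norm_zero[OF Mx]] .
  then have "\<forall>\<^sub>F k in sequentially. norm (M (x k)) * (R + B) < d n * (r / 2)"
    using d[of n] \<open>r > 0\<close> by (intro order_tendstoD) auto
  then show ?thesis
  proof eventually_elim
    case (elim k)
    have Mz: "M (z n) = - d n *\<^sub>R z n" using z by (simp add: eq_neg_iff_add_eq_0)
    have "0 \<le> inner (M (x k) - M (z n)) (x k - z n)"
      using mono by (simp add: monotone_operator_def)
    also have "\<dots> = inner (M (x k)) (x k - z n) + d n * inner (z n) (x k - z n)"
      by (simp add: Mz inner_add_left)
    also have "inner (M (x k)) (x k - z n) \<le> norm (M (x k)) * norm (x k - z n)"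
      by (rule norm_cauchy_schwarz)
    also have "\<dots> \<le> norm (M (x k)) * (R + B)"
      using norm_triangle_ineq4[of "x k" "z n"] bdd[of k] B[of n]
      by (intro mult_left_mono) auto
    finally have "d n * (- inner (z n) (x k - z n)) \<le> d n * (r / 2)" using elim by simp
    then have n_bound: "- inner (z n) (x k - z n) \<le> r / 2"
      using d[of n] by (simp only: mult_le_cancel_left_pos)
    have "inner (z n) (x k - z n) - inner z' (x k - z')
        = inner (z n - z') (x k - z n) - inner z' (z n - z')"
      by (simp add: inner_diff_left inner_diff_right inner_commute)
    also have "\<dots> \<le> norm (z n - z') * norm (x k - z n) + norm z' * norm (z n - z')"
      using norm_cauchy_schwarz[of "z n - z'" "x k - z n"]
        norm_cauchy_schwarz[of "- z'" "z n - z'"] by simp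
    also have "\<dots> \<le> q * (R + B) + B * q"
      using n \<open>norm z' \<le> B\<close> norm_triangle_ineq4[of "x k" "z n"] bdd[of k] B[of n] B0 q
      by (intro add_mono mult_mono) auto
    also have "\<dots> \<le> r / 4" using q(2) by (simp add: algebra_simps)
    finally show ?case using n_bound \<open>r > 0\<close> by linarith
  qed
qed

text \<open>
  The variational inequality says that \<open>z\<close> is the metric projection of the origin onto the set
  of zeros; the obtuse angle at \<open>z\<close> yields both minimality and uniqueness.
\<close>

lemma min_norm_zero_characterization:
  fixes M :: "'a::real_inner \<Rightarrow> 'a"
  assumes z: "M z = 0" and vi: "\<And>w. M w = 0 \<Longrightarrow> inner z (w - z) \<ge> 0"
  shows "is_min_norm_element (zer M) w \<longleftrightarrow> w = z"
proof -
  have pyth: "(norm z)\<^sup>2 + (norm (w - z))\<^sup>2 \<le> (norm w)\<^sup>2" if "M w = 0" for w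
  proof -
    have "(norm w)\<^sup>2 = (norm z)\<^sup>2 + (norm (w - z))\<^sup>2 + 2 * inner z (w - z)"
      unfolding power2_norm_eq_inner
      by (simp add: inner_diff_left inner_diff_right inner_commute)
    then show ?thesis using vi[OF that] by simp
  qed
  have le: "norm z \<le> norm w" if "M w = 0" for w
  proof (rule power2_le_imp_le)
    show "(norm z)\<^sup>2 \<le> (norm w)\<^sup>2"
      using pyth[OF that] zero_le_power2[of "norm (w - z)"] by linarith
  qed simp
  show ?thesis
  proof
    assume "w = z" then show "is_min_norm_element (zer M) w"
      using z le by (simp add: is_min_norm_element_def zer_def)
  next
    assume "is_min_norm_element (zer M) w"
    then have w: "M w = 0" "norm w \<le> norm z"
      using z by (auto simp: is_min_norm_element_def zer_def)
    then have "(norm w)\<^sup>2 \<le> (norm z)\<^sup>2" by (simp add: power_mono)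
    with pyth[OF w(1)] have "(norm (w - z))\<^sup>2 \<le> 0" by linarith
    then show "w = z" by simp
  qed
qed

section \<open>One step of the iteration\<close>

text \<open>
  The usual extragradient computation. Expanding the square and testing monotonicity at \<open>y\<close>
  against the zero \<open>z\<close> leaves \<open>- \<parallel>A\<parallel>\<^sup>2 - \<parallel>B\<parallel>\<^sup>2\<close>, with \<open>A = x - y\<close> and \<open>B = x' - y\<close>, against two error
  terms. The Lipschitz error \<open>2 \<theta> \<langle>M x - M y, B\<rangle>\<close> uses up the fraction \<open>\<theta> L\<close> of these squares,
  and the remaining fraction \<open>1 - \<theta> L\<close> of \<open>\<parallel>B\<parallel>\<^sup>2\<close> absorbs \<open>2 \<theta> e \<langle>x, B\<rangle>\<close>, which costs a term
  quadratic in \<open>e\<close>.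
\<close>

lemma energy_step:
  fixes M :: "'a::real_inner \<Rightarrow> 'a"
  assumes mono: "monotone_operator M" and lip: "L-lipschitz_on UNIV M"
    and \<theta>: "0 < \<theta>" "\<theta> * L < 1"
    and y: "y = x - (\<theta> * e) *\<^sub>R x - \<theta> *\<^sub>R M x"
    and x': "x' = x - (\<theta> * e') *\<^sub>R x' - \<theta> *\<^sub>R M y"
    and z: "M z = 0"
  shows "(norm (x' - z))\<^sup>2 \<le> (norm (x - z))\<^sup>2 - 2 * (\<theta> * e') * inner x' (x' - z)
    + (\<theta> * e * norm x)\<^sup>2 / (1 - \<theta> * L)"
proof -
  define A where "A = x - y"
  define B where "B = x' - y"
  define c where "c = 1 - \<theta> * L"
  have c: "c > 0" using \<theta> by (simp add: c_def)
  have A: "A = (\<theta> * e) *\<^sub>R x + \<theta> *\<^sub>R M x" by (simp add: A_def y)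
  have D: "A - B = (\<theta> * e') *\<^sub>R x' + \<theta> *\<^sub>R M y"
    using x' by (simp add: A_def B_def algebra_simps)
  have "(norm (x' - z))\<^sup>2 = (norm (x - z))\<^sup>2 - (norm (A - B))\<^sup>2 - 2 * inner (A - B) (x' - z)"
    unfolding A_def B_def power2_norm_eq_inner
    by (simp add: inner_diff_left inner_diff_right inner_commute)
  also have "inner (A - B) (x' - z)
      = \<theta> * e' * inner x' (x' - z) + \<theta> * inner (M y) (y - z) + \<theta> * inner (M y) B"
    unfolding D by (simp add: B_def inner_add_left inner_diff_right algebra_simps)
  also have "(norm (A - B))\<^sup>2 = (norm A)\<^sup>2 + (norm B)\<^sup>2 - 2 * inner A B"
    unfolding power2_norm_eq_inner
    by (simp add: inner_diff_left inner_diff_right inner_commute)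
  also have "inner A B = \<theta> * e * inner x B + \<theta> * inner (M x) B"
    unfolding A by (simp add: inner_add_left)
  finally have id: "(norm (x' - z))\<^sup>2 = (norm (x - z))\<^sup>2 - 2 * (\<theta> * e') * inner x' (x' - z)
      - (norm A)\<^sup>2 - (norm B)\<^sup>2 - 2 * (\<theta> * inner (M y) (y - z))
      + 2 * (\<theta> * inner (M x - M y) B) + 2 * (\<theta> * e * inner x B)"
    by (simp add: inner_diff_left algebra_simps)
  have "inner (M y) (y - z) \<ge> 0"
    using mono[unfolded monotone_operator_def, rule_format, of y z] by (simp add: z)
  then have 1: "\<theta> * inner (M y) (y - z) \<ge> 0" using \<theta> by simp
  have "norm (M x - M y) \<le> L * norm A"
    using lipschitz_onD[OF lip, of x y] by (simp add: dist_norm A_def)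
  then have "inner (M x - M y) B \<le> L * norm A * norm B"
    using norm_cauchy_schwarz[of "M x - M y" B] by (meson mult_right_mono norm_ge_zero order_trans)
  then have "\<theta> * inner (M x - M y) B \<le> \<theta> * L * (norm A * norm B)"
    using \<theta> by (simp add: mult.assoc)
  moreover have "\<theta> * L * (2 * (norm A * norm B)) \<le> \<theta> * L * ((norm A)\<^sup>2 + (norm B)\<^sup>2)"
    using \<theta> lipschitz_on_nonneg[OF lip] sum_squares_bound[of "norm A" "norm B"]
    by (intro mult_left_mono) auto
  ultimately have 2: "2 * (\<theta> * inner (M x - M y) B) \<le> (1 - c) * ((norm A)\<^sup>2 + (norm B)\<^sup>2)"
    by (simp add: c_def)
  have "0 \<le> (norm (c *\<^sub>R B - (\<theta> * e) *\<^sub>R x))\<^sup>2 / c" using c by simp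
  also have "\<dots> = c * (norm B)\<^sup>2 + (\<theta> * e * norm x)\<^sup>2 / c - 2 * (\<theta> * e * inner x B)"
    unfolding power2_norm_eq_inner power_mult_distrib using c
    by (simp add: inner_diff_left inner_diff_right inner_commute power2_eq_square field_simps)
  finally have 3: "2 * (\<theta> * e * inner x B) \<le> c * (norm B)\<^sup>2 + (\<theta> * e * norm x)\<^sup>2 / c" by simp
  have "c * (norm A)\<^sup>2 \<ge> 0" using c by simp
  with id 1 2 3 show ?thesis unfolding c_def[symmetric] by (simp add: algebra_simps)
qed

text \<open>
  Half the squared norm of the residual changes by
  \<open>\<langle>u' - u, v\<rangle> + \<parallel>u' - v\<parallel>\<^sup>2 / 2 - \<parallel>v - u\<parallel>\<^sup>2 / 2\<close>. Since \<open>x' - x = - \<theta> v\<close>, monotonicity between \<open>x\<close> and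
  \<open>x'\<close> bounds the first term. Since \<open>u' - v = M x' - M y\<close> and \<open>x' - y = - \<theta> (v - u)\<close>,
  the Lipschitz bound makes the second term the fraction \<open>(\<theta> L)\<^sup>2\<close> of the third.
\<close>

lemma residual_step:
  fixes M :: "'a::real_inner \<Rightarrow> 'a"
  assumes mono: "monotone_operator M" and lip: "L-lipschitz_on UNIV M"
    and \<theta>: "0 < \<theta>"
    and y: "y = x - (\<theta> * e) *\<^sub>R x - \<theta> *\<^sub>R M x"
    and x': "x' = x - (\<theta> * e') *\<^sub>R x' - \<theta> *\<^sub>R M y"
  defines "u \<equiv> M x + e *\<^sub>R x" and "u' \<equiv> M x' + e' *\<^sub>R x'" and "v \<equiv> M y + e' *\<^sub>R x'"
  shows "(norm u')\<^sup>2 / 2 \<le> (norm u)\<^sup>2 / 2 - \<theta> * e * (norm v)\<^sup>2 + (e' - e) * inner x' v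
    - (1 - (\<theta> * L)\<^sup>2) / 2 * (norm (v - u))\<^sup>2"
proof -
  have step: "x' - x = - (\<theta> *\<^sub>R v)"
    unfolding v_def by (subst x') (simp add: algebra_simps)
  have "x' - y = - (\<theta> *\<^sub>R (v - u))"
    using step unfolding y u_def by (simp add: algebra_simps)
  then have "norm (x' - y) = \<theta> * norm (v - u)" using \<theta> by simp
  moreover have "norm (u' - v) \<le> L * norm (x' - y)"
    using lipschitz_onD[OF lip, of x' y] by (simp add: dist_norm u'_def v_def)
  ultimately have "norm (u' - v) \<le> \<theta> * L * norm (v - u)" by (simp add: mult_ac)
  then have lipv: "(norm (u' - v))\<^sup>2 \<le> (\<theta> * L)\<^sup>2 * (norm (v - u))\<^sup>2"
    by (metis norm_ge_zero power_mono power_mult_distrib)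
  have "M x' - M x = u' - u - e *\<^sub>R (x' - x) - (e' - e) *\<^sub>R x'"
    by (simp add: u_def u'_def algebra_simps)
  then have "0 \<le> inner (u' - u - e *\<^sub>R (x' - x) - (e' - e) *\<^sub>R x') (x' - x)"
    using mono[unfolded monotone_operator_def, rule_format, of x' x] by simp
  also have "\<dots> = \<theta> * (- inner (u' - u) v - \<theta> * e * (norm v)\<^sup>2 + (e' - e) * inner x' v)"
    unfolding step power2_norm_eq_inner by (simp add: inner_diff_left inner_add_left algebra_simps)
  finally have monov: "inner (u' - u) v \<le> - (\<theta> * e * (norm v)\<^sup>2) + (e' - e) * inner x' v"
    using \<theta> by (simp add: zero_le_mult_iff)
  have "(norm u')\<^sup>2 / 2 - (norm u)\<^sup>2 / 2
      = inner (u' - u) v + (norm (u' - v))\<^sup>2 / 2 - (norm (v - u))\<^sup>2 / 2"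
    unfolding power2_norm_eq_inner
    by (simp add: inner_diff_left inner_diff_right inner_commute field_simps)
  with monov lipv show ?thesis by (simp add: field_simps)
qed

text \<open>
  The contraction of \<open>residual_step\<close> is in terms of \<open>v\<close>; Young's inequality exchanges \<open>v\<close> for
  \<open>u\<close> at the price of a multiple of \<open>e \<parallel>v - u\<parallel>\<^sup>2\<close>, which the negative last term of
  \<open>residual_step\<close> pays for once \<open>e\<close> is small. The loss \<open>\<delta>\<close> in the rate is split evenly: one half
  \<open>h\<close> absorbs the drift \<open>(e' - e) \<langle>x', v\<rangle>\<close>, the other the exchange, and
  \<open>(1 - h)\<^sup>2 \<ge> 1 - \<delta>\<close>.
\<close>

lemma residual_contraction:
  fixes M :: "'a::real_inner \<Rightarrow> 'a"
  assumes mono: "monotone_operator M" and lip: "L-lipschitz_on UNIV M"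
    and \<theta>: "0 < \<theta>" and \<delta>: "0 < \<delta>" "\<delta> < 1"
    and e: "0 < e" "\<theta> * e * (2 / \<delta>) \<le> (1 - (\<theta> * L)\<^sup>2) / 2" and R: "norm x' \<le> R"
    and y: "y = x - (\<theta> * e) *\<^sub>R x - \<theta> *\<^sub>R M x"
    and x': "x' = x - (\<theta> * e') *\<^sub>R x' - \<theta> *\<^sub>R M y"
  shows "(norm (M x' + e' *\<^sub>R x'))\<^sup>2 / 2
    \<le> (1 - 2 * (1 - \<delta>) * \<theta> * e) * ((norm (M x + e *\<^sub>R x))\<^sup>2 / 2)
      + \<theta> * R\<^sup>2 / (2 * \<delta>) * (e * ((e' - e) / (\<theta> * e))\<^sup>2)"
proof -
  define u where "u = M x + e *\<^sub>R x"
  define v where "v = M y + e' *\<^sub>R x'"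
  define w where "w = v - u"
  define h where "h = \<delta> / 2"
  have h: "0 < h" "h < 1 / 2" using \<delta> by (auto simp: h_def)
  have te: "\<theta> * e > 0" using \<theta> e by simp
  note step = residual_step[OF mono lip \<theta> y x', folded u_def v_def w_def]
  \<comment> \<open>the weight in Young's inequality for the drift term\<close>
  define a where "a = \<theta> * e * h"
  have a: "a > 0" using te h by (simp add: a_def)
  have "0 \<le> (norm (a *\<^sub>R v - ((e' - e) / 2) *\<^sub>R x'))\<^sup>2 / a" using a by simp
  also have "\<dots> = a * (norm v)\<^sup>2 + (e' - e)\<^sup>2 / (4 * a) * (norm x')\<^sup>2 - (e' - e) * inner x' v"
    unfolding power2_norm_eq_inner using a
    by (simp add: inner_diff_left inner_diff_right inner_commute power2_eq_square field_simps)
  finally have "(e' - e) * inner x' v \<le> a * (norm v)\<^sup>2 + (e' - e)\<^sup>2 / (4 * a) * (norm x')\<^sup>2"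
    by simp
  also have "(e' - e)\<^sup>2 / (4 * a) * (norm x')\<^sup>2 \<le> (e' - e)\<^sup>2 / (4 * a) * R\<^sup>2"
    using a R by (intro mult_left_mono power_mono) auto
  also have "(e' - e)\<^sup>2 / (4 * a) * R\<^sup>2 = \<theta> * R\<^sup>2 / (2 * \<delta>) * (e * ((e' - e) / (\<theta> * e))\<^sup>2)"
    using \<theta> e \<delta> by (simp add: a_def h_def power2_eq_square field_simps)
  finally have drift: "(e' - e) * inner x' v
      \<le> a * (norm v)\<^sup>2 + \<theta> * R\<^sup>2 / (2 * \<delta>) * (e * ((e' - e) / (\<theta> * e))\<^sup>2)" by simp
  \<comment> \<open>this square is Young's inequality with weight \<open>h\<close> for \<open>v = u + w\<close>\<close>
  have "0 \<le> (norm (h *\<^sub>R u + w))\<^sup>2 / h" using h by simp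
  also have "\<dots> = (norm v)\<^sup>2 - (1 - h) * (norm u)\<^sup>2 + (1 / h - 1) * (norm w)\<^sup>2"
    unfolding power2_norm_eq_inner w_def using h
    by (simp add: inner_diff_left inner_diff_right inner_add_left inner_add_right inner_commute
        power2_eq_square field_simps)
  finally have "(1 - h) * (norm u)\<^sup>2 - 1 / h * (norm w)\<^sup>2 \<le> (norm v)\<^sup>2"
    using zero_le_power2[of "norm w"] unfolding left_diff_distrib by linarith
  then have "\<theta> * e * (1 - h) * ((1 - h) * (norm u)\<^sup>2 - 1 / h * (norm w)\<^sup>2)
      \<le> \<theta> * e * (1 - h) * (norm v)\<^sup>2"
    using te h by (intro mult_left_mono) auto
  moreover have "\<theta> * e * (1 - \<delta>) * (norm u)\<^sup>2 \<le> \<theta> * e * (1 - h) * ((1 - h) * (norm u)\<^sup>2)"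
  proof -
    have "1 - \<delta> \<le> (1 - h) * (1 - h)" by (simp add: h_def algebra_simps)
    then have "(\<theta> * e * (norm u)\<^sup>2) * (1 - \<delta>) \<le> (\<theta> * e * (norm u)\<^sup>2) * ((1 - h) * (1 - h))"
      using te by (intro mult_left_mono) auto
    then show ?thesis by (simp only: mult_ac)
  qed
  moreover have "\<theta> * e * (1 - h) * (1 / h * (norm w)\<^sup>2) \<le> (1 - (\<theta> * L)\<^sup>2) / 2 * (norm w)\<^sup>2"
  proof -
    have "\<theta> * e * (1 - h) * (1 / h) \<le> \<theta> * e * 1 * (1 / h)"
      using te h by (intro mult_right_mono mult_left_mono) auto
    also have "\<dots> \<le> (1 - (\<theta> * L)\<^sup>2) / 2" using e by (simp add: h_def)
    finally have "\<theta> * e * (1 - h) * (1 / h) * (norm w)\<^sup>2 \<le> (1 - (\<theta> * L)\<^sup>2) / 2 * (norm w)\<^sup>2"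
      by (rule mult_right_mono) simp
    then show ?thesis by (simp only: mult.assoc)
  qed
  ultimately have "\<theta> * e * (1 - \<delta>) * (norm u)\<^sup>2
      \<le> \<theta> * e * (norm v)\<^sup>2 - a * (norm v)\<^sup>2 + (1 - (\<theta> * L)\<^sup>2) / 2 * (norm w)\<^sup>2"
    by (simp only: a_def right_diff_distrib left_diff_distrib mult_1_right)
  with step drift show ?thesis unfolding u_def[symmetric] by (simp add: algebra_simps)
qed


section \<open>The iteration\<close>

locale tikhonov_extragradient =
  fixes M :: "'a::{real_inner, complete_space} \<Rightarrow> 'a"
    and L \<theta> :: real and \<epsilon> :: "nat \<Rightarrow> real" and x y :: "nat \<Rightarrow> 'a"
  assumes L_pos: "L > 0"
    and mono: "monotone_operator M"
    and lip: "L-lipschitz_on UNIV M"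
    and zeros: "zer M \<noteq> {}"
    and theta_pos: "0 < \<theta>" and theta_less: "\<theta> < 1 / L"
    and eps_pos: "\<And>k. \<epsilon> k > 0"
    and eps_lim: "\<epsilon> \<longlonglongrightarrow> 0"
    and eps_sum: "filterlim (\<lambda>n. \<Sum>k\<le>n. \<epsilon> k) at_top sequentially"
    and eps_ratio: "(\<lambda>k. \<bar>\<epsilon> (Suc k) - \<epsilon> k\<bar> / \<epsilon> k) \<longlonglongrightarrow> 0"
    and y_step: "\<And>k. y (Suc k) = x k - (\<theta> * \<epsilon> k) *\<^sub>R x k - \<theta> *\<^sub>R M (x k)"
    and x_step: "\<And>k. x (Suc k) = x k - (\<theta> * \<epsilon> (Suc k)) *\<^sub>R x (Suc k) - \<theta> *\<^sub>R M (y (Suc k))"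
begin

lemma theta_L: "0 < \<theta> * L" "\<theta> * L < 1"
  using L_pos theta_pos theta_less by (simp_all add: field_simps)

lemma eventually_eps_le:
  assumes "c > 0" shows "\<forall>\<^sub>F k in sequentially. \<epsilon> k \<le> c"
  using order_tendstoD(2)[OF eps_lim assms] by eventually_elim simp

lemma eventually_eps_le_twice_Suc: "\<forall>\<^sub>F k in sequentially. \<epsilon> k \<le> 2 * \<epsilon> (Suc k)"
proof -
  have "\<forall>\<^sub>F k in sequentially. \<bar>\<epsilon> (Suc k) - \<epsilon> k\<bar> / \<epsilon> k < 1 / 2"
    by (rule order_tendstoD(2)[OF eps_ratio]) simp
  then show ?thesis
  proof eventually_elim
    case (elim k)
    have "- (\<epsilon> (Suc k) - \<epsilon> k) \<le> \<bar>\<epsilon> (Suc k) - \<epsilon> k\<bar>" by (rule abs_ge_minus_self)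
    also have "\<dots> < 1 / 2 * \<epsilon> k" using elim eps_pos[of k] by (simp only: pos_divide_less_eq)
    finally show ?case by simp
  qed
qed

lemma not_summable_eps: "\<not> summable \<epsilon>"
proof
  assume "summable \<epsilon>"
  then have "(\<Sum>k\<le>n. \<epsilon> k) \<le> suminf \<epsilon>" for n
    using eps_pos by (intro sum_le_suminf) (auto intro: less_imp_le)
  moreover obtain n where "(\<Sum>k\<le>n. \<epsilon> k) > suminf \<epsilon>"
    using eps_sum unfolding filterlim_at_top_dense
    by (metis eventually_sequentially order_refl)
  ultimately show False by (metis not_less)
qed

text \<open>
  In the energy estimate the regularisation contributes
  \<open>- 2 t \<langle>x', x' - z\<rangle> \<le> t (\<parallel>z\<parallel>\<^sup>2 - \<parallel>x' - z\<parallel>\<^sup>2)\<close> with \<open>t = \<theta> \<epsilon>\<^sub>k\<^sub>+\<^sub>1\<close>, while the error is quadratic in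
  \<open>\<epsilon>\<^sub>k\<close> and so eventually a small fraction of \<open>t\<close>. The result has the form
  \<open>(1 + t) a' \<le> (1 + t / 2) a + (t / 2) (3 \<parallel>z\<parallel>\<^sup>2)\<close>, which preserves every bound
  \<open>a \<le> A\<close> with \<open>A \<ge> 3 \<parallel>z\<parallel>\<^sup>2\<close>.
\<close>

lemma iterates_bounded: "\<exists>R. \<forall>k. norm (x k) \<le> R"
proof -
  obtain z where z: "M z = 0" using zeros by (auto simp: zer_def)
  define a where "a k = (norm (x k - z))\<^sup>2" for k
  define c where "c = \<theta>\<^sup>2 / (1 - \<theta> * L)"
  have c: "c > 0" using theta_L theta_pos by (simp add: c_def)
  \<comment> \<open>the quadratic error at index \<open>k\<close> has to be compared with the gain at index \<open>k + 1\<close>\<close>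
  have "\<forall>\<^sub>F k in sequentially. \<epsilon> k \<le> \<theta> / (8 * c)"
    using c theta_pos by (intro eventually_eps_le) simp
  then have "\<forall>\<^sub>F k in sequentially. 4 * (c * (\<epsilon> k)\<^sup>2) \<le> \<theta> * \<epsilon> (Suc k)"
    using eventually_eps_le_twice_Suc
  proof eventually_elim
    case (elim k)
    have "4 * (c * (\<epsilon> k)\<^sup>2) = (4 * c * \<epsilon> k) * \<epsilon> k" by (simp add: power2_eq_square)
    also have "\<dots> \<le> (4 * c * \<epsilon> k) * (2 * \<epsilon> (Suc k))"
      using elim c eps_pos[of k] by (intro mult_left_mono) auto
    also have "\<dots> = (8 * c * \<epsilon> k) * \<epsilon> (Suc k)" by simp
    also have "\<dots> \<le> \<theta> * \<epsilon> (Suc k)"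
      using elim c eps_pos[of "Suc k"] by (intro mult_right_mono) (auto simp: field_simps)
    finally show ?case .
  qed
  then obtain N where N: "\<And>k. k \<ge> N \<Longrightarrow> 4 * (c * (\<epsilon> k)\<^sup>2) \<le> \<theta> * \<epsilon> (Suc k)"
    unfolding eventually_sequentially by blast
  define A where "A = max (a N) (3 * (norm z)\<^sup>2)"
  have "a k \<le> A" if "k \<ge> N" for k
    using that
  proof (induction k rule: dec_induct)
    case base then show ?case by (simp add: A_def)
  next
    case (step k)
    define t where "t = \<theta> * \<epsilon> (Suc k)"
    have t: "t > 0" using theta_pos eps_pos by (simp add: t_def)
    have "a (Suc k) \<le> a k - 2 * t * inner (x (Suc k)) (x (Suc k) - z)
        + c * (\<epsilon> k)\<^sup>2 * (norm (x k))\<^sup>2"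
      using energy_step[OF mono lip theta_pos theta_L(2) y_step x_step z]
      by (simp add: a_def c_def t_def power_mult_distrib)
    moreover have "2 * inner (x (Suc k)) (x (Suc k) - z)
        = (norm (x (Suc k)))\<^sup>2 + a (Suc k) - (norm z)\<^sup>2"
      unfolding a_def power2_norm_eq_inner
      by (simp add: inner_diff_left inner_diff_right inner_commute)
    then have "a (Suc k) - (norm z)\<^sup>2 \<le> 2 * inner (x (Suc k)) (x (Suc k) - z)" by simp
    then have "t * (a (Suc k) - (norm z)\<^sup>2) \<le> t * (2 * inner (x (Suc k)) (x (Suc k) - z))"
      using t by (intro mult_left_mono) auto
    moreover have "c * (\<epsilon> k)\<^sup>2 * (norm (x k))\<^sup>2 \<le> t / 4 * (2 * a k + 2 * (norm z)\<^sup>2)"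
    proof (intro mult_mono)
      show "c * (\<epsilon> k)\<^sup>2 \<le> t / 4" using N[OF step(1)] by (simp add: t_def)
      have "2 * a k + 2 * (norm z)\<^sup>2 - (norm (x k))\<^sup>2 = (norm (x k - 2 *\<^sub>R z))\<^sup>2"
        unfolding a_def power2_norm_eq_inner
        by (simp add: inner_diff_left inner_diff_right inner_commute)
      then show "(norm (x k))\<^sup>2 \<le> 2 * a k + 2 * (norm z)\<^sup>2"
        by (metis diff_ge_0_iff_ge zero_le_power2)
    qed (use t in auto)
    ultimately have "(1 + t) * a (Suc k) \<le> (1 + t / 2) * a k + t / 2 * (3 * (norm z)\<^sup>2)"
      by (simp add: algebra_simps)
    also have "\<dots> \<le> (1 + t / 2) * A + t / 2 * A"
      using t step.IH by (intro add_mono mult_left_mono) (auto simp: A_def)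
    also have "\<dots> = (1 + t) * A" by (simp add: algebra_simps)
    finally show ?case using t by (simp add: mult_le_cancel_left_pos)
  qed
  then have tail: "norm (x k) \<le> sqrt A + norm z" if "k \<ge> N" for k
    using that real_le_rsqrt[of "norm (x k - z)" A] norm_triangle_sub[of "x k" z]
    unfolding a_def by fastforce
  define R where "R = max (sqrt A + norm z) (Max ((\<lambda>k. norm (x k)) ` {..N}))"
  have "norm (x k) \<le> R" for k
  proof (cases "k \<ge> N")
    case True then show ?thesis using tail[OF True] by (simp add: R_def)
  next
    case False
    then have "norm (x k) \<le> Max ((\<lambda>k. norm (x k)) ` {..N})" by (intro Max_ge) auto
    then show ?thesis by (simp add: R_def)
  qed
  then show ?thesis by blast
qed

lemma psi_recursion:
  assumes R: "\<And>k. norm (x k) \<le> R" and \<delta>: "0 < \<delta>" "\<delta> < 1"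
  shows "\<forall>\<^sub>F k in sequentially. psi M \<epsilon> x (Suc k) \<le> gamma_factor \<delta> \<theta> \<epsilon> k * psi M \<epsilon> x k
    + \<theta> * R\<^sup>2 / (2 * \<delta>) * (\<epsilon> k * ((\<epsilon> (Suc k) - \<epsilon> k) / (\<theta> * \<epsilon> k))\<^sup>2)"
proof -
  have "(\<theta> * L)\<^sup>2 < 1" using theta_L by (simp add: power_less_one_iff)
  moreover have pos: "\<theta> * (2 / \<delta>) > 0" using theta_pos \<delta> by simp
  ultimately have "(1 - (\<theta> * L)\<^sup>2) / 2 / (\<theta> * (2 / \<delta>)) > 0"
    by (intro divide_pos_pos) auto
  then have "\<forall>\<^sub>F k in sequentially. \<epsilon> k \<le> (1 - (\<theta> * L)\<^sup>2) / 2 / (\<theta> * (2 / \<delta>))"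
    by (rule eventually_eps_le)
  then show ?thesis
  proof eventually_elim
    case (elim k)
    then have "\<theta> * \<epsilon> k * (2 / \<delta>) \<le> (1 - (\<theta> * L)\<^sup>2) / 2"
      unfolding pos_le_divide_eq[OF pos] by (simp only: mult_ac)
    from residual_contraction[OF mono lip theta_pos \<delta> eps_pos this R y_step x_step]
    show ?case by (simp add: psi_def gamma_factor_def)
  qed
qed

text \<open>
  With \<open>\<delta> = 1 / 2\<close> the contraction factor is \<open>1 - \<theta> \<epsilon>\<^sub>k\<close>, and the error relative to \<open>\<theta> \<epsilon>\<^sub>k\<close> is a
  multiple of \<open>((\<epsilon>\<^sub>k\<^sub>+\<^sub>1 - \<epsilon>\<^sub>k) / \<epsilon>\<^sub>k)\<^sup>2\<close>, which vanishes.
\<close>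

lemma residual_tendsto_zero: "(\<lambda>k. M (x k)) \<longlonglongrightarrow> 0"
proof -
  obtain R where R: "\<And>k. norm (x k) \<le> R" using iterates_bounded by blast
  have "psi M \<epsilon> x \<longlonglongrightarrow> 0"
  proof (rule vanishing_recursion)
    define s where "s k = R\<^sup>2 / \<theta>\<^sup>2 * (\<bar>\<epsilon> (Suc k) - \<epsilon> k\<bar> / \<epsilon> k)\<^sup>2" for k
    show "\<forall>\<^sub>F k in sequentially. psi M \<epsilon> x (Suc k)
        \<le> (1 - \<theta> * \<epsilon> k) * psi M \<epsilon> x k + \<theta> * \<epsilon> k * s k"
      using psi_recursion[OF R, of "1 / 2", simplified]
    proof eventually_elim
      case (elim k)
      have "\<theta> * R\<^sup>2 * (\<epsilon> k * ((\<epsilon> (Suc k) - \<epsilon> k) / (\<theta> * \<epsilon> k))\<^sup>2) = \<theta> * \<epsilon> k * s k"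
        by (simp add: s_def power_divide power_mult_distrib)
      with elim show ?case by (simp add: gamma_factor_def)
    qed
    have "s \<longlonglongrightarrow> R\<^sup>2 / \<theta>\<^sup>2 * 0\<^sup>2" unfolding s_def by (intro tendsto_intros eps_ratio)
    then have s_lim: "s \<longlonglongrightarrow> 0" by simp
    show "\<forall>\<^sub>F k in sequentially. s k \<le> r" if "r > 0" for r
      using order_tendstoD(2)[OF s_lim that] by (rule eventually_mono) simp
    show "\<forall>\<^sub>F k in sequentially. 0 \<le> \<theta> * \<epsilon> k \<and> \<theta> * \<epsilon> k \<le> 1"
      using eventually_eps_le[of "1 / \<theta>"] theta_pos eps_pos
      by (auto elim!: eventually_mono simp: field_simps less_imp_le)
    show "\<not> summable (\<lambda>k. \<theta> * \<epsilon> k)"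
      using not_summable_eps theta_pos by (simp add: summable_cmult_iff)
  qed (simp add: psi_def)
  then have "(\<lambda>k. sqrt (2 * psi M \<epsilon> x k)) \<longlonglongrightarrow> sqrt (2 * 0)" by (intro tendsto_intros)
  then have "(\<lambda>k. norm (M (x k) + \<epsilon> k *\<^sub>R x k)) \<longlonglongrightarrow> 0" by (simp add: psi_def)
  then have "(\<lambda>k. M (x k) + \<epsilon> k *\<^sub>R x k) \<longlonglongrightarrow> 0" by (simp add: tendsto_norm_zero_iff)
  moreover have "(\<lambda>k. \<epsilon> k *\<^sub>R x k) \<longlonglongrightarrow> 0"
  proof (rule Lim_null_comparison)
    show "\<forall>\<^sub>F k in sequentially. norm (\<epsilon> k *\<^sub>R x k) \<le> \<epsilon> k * R"
      using R eps_pos by (simp add: abs_of_pos less_imp_le)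
    show "(\<lambda>k. \<epsilon> k * R) \<longlonglongrightarrow> 0" using tendsto_mult_left_zero[OF eps_lim] .
  qed
  ultimately have "(\<lambda>k. M (x k) + \<epsilon> k *\<^sub>R x k - \<epsilon> k *\<^sub>R x k) \<longlonglongrightarrow> 0 - 0"
    by (rule tendsto_diff)
  then show ?thesis by simp
qed

text \<open>
  Splitting \<open>\<langle>x', x' - z\<rangle> = \<parallel>x' - z\<parallel>\<^sup>2 + \<langle>z, x' - z\<rangle>\<close> in the energy estimate gives
  \<open>(1 + 2 t) a' \<le> a + 2 t s\<close>, a vanishing recursion with weight \<open>b = 2 t / (1 + 2 t)\<close>: the upper
  limit of \<open>s\<close> is at most 0 by the asymptotic inequality, the quadratic error being of order
  \<open>t \<epsilon>\<^sub>k\<close>.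
\<close>

lemma iterates_converge:
  assumes z: "M z = 0"
    and asym: "\<And>r. r > 0 \<Longrightarrow> \<forall>\<^sub>F k in sequentially. - inner z (x k - z) \<le> r"
  shows "x \<longlonglongrightarrow> z"
proof -
  obtain R where R: "\<And>k. norm (x k) \<le> R" using iterates_bounded by blast
  define a where "a k = (norm (x k - z))\<^sup>2" for k
  define c where "c = \<theta> / (1 - \<theta> * L) * R\<^sup>2"
  have c: "c \<ge> 0" using theta_L theta_pos by (simp add: c_def)
  define t where "t k = \<theta> * \<epsilon> (Suc k)" for k
  have t: "t k > 0" for k using theta_pos eps_pos by (simp add: t_def)
  define b where "b k = 2 * t k / (1 + 2 * t k)" for k
  define s where "s k = - inner z (x (Suc k) - z) + c * \<epsilon> k" for k
  have "a \<longlonglongrightarrow> 0"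
  proof (rule vanishing_recursion)
    show "0 \<le> a k" for k by (simp add: a_def)
    show "\<forall>\<^sub>F k in sequentially. 0 \<le> b k \<and> b k \<le> 1"
    proof (intro always_eventually allI)
      fix k show "0 \<le> b k \<and> b k \<le> 1" using t[of k] by (simp add: b_def)
    qed
    show "\<not> summable b"
    proof
      assume "summable b"
      have "\<forall>\<^sub>F k in sequentially. \<epsilon> (Suc k) \<le> 1 / (2 * \<theta>)"
        using eventually_eps_le[of "1 / (2 * \<theta>)"] theta_pos
        by (simp add: eventually_sequentially_Suc[of "\<lambda>k. \<epsilon> k \<le> 1 / (2 * \<theta>)"])
      then have "\<forall>\<^sub>F k in sequentially. norm (t k) \<le> b k"
      proof eventually_elim
        case (elim k)
        then have "2 * t k \<le> 1" using theta_pos by (simp add: t_def field_simps)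
        then have "t k * (1 + 2 * t k) \<le> t k * 2" using t[of k] by (intro mult_left_mono) auto
        then show ?case using t[of k] by (simp add: b_def field_simps)
      qed
      then have "summable t" using \<open>summable b\<close> by (rule summable_comparison_test_ev)
      then have "summable (\<lambda>k. \<epsilon> (Suc k))"
        using theta_pos by (simp add: t_def[abs_def] summable_cmult_iff)
      then show False using not_summable_eps by (simp add: summable_Suc_iff)
    qed
    show "\<forall>\<^sub>F k in sequentially. s k \<le> r" if "r > 0" for r
    proof -
      have "\<forall>\<^sub>F k in sequentially. - inner z (x (Suc k) - z) \<le> r / 2"
        using asym[of "r / 2"] that
          eventually_sequentially_Suc[of "\<lambda>k. - inner z (x k - z) \<le> r / 2"] by simp
      moreover have "\<forall>\<^sub>F k in sequentially. \<epsilon> k \<le> r / (2 * (c + 1))"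
        using c that by (intro eventually_eps_le) simp
      ultimately show ?thesis
      proof eventually_elim
        case (elim k)
        have "c * \<epsilon> k \<le> (c + 1) * \<epsilon> k" using eps_pos[of k] by simp
        also have "\<dots> \<le> r / 2" using elim c by (simp add: field_simps)
        finally show ?case using elim by (simp add: s_def)
      qed
    qed
    show "\<forall>\<^sub>F k in sequentially. a (Suc k) \<le> (1 - b k) * a k + b k * s k"
      using eventually_eps_le_twice_Suc
    proof eventually_elim
      case (elim k)
      have energy: "a (Suc k) \<le> a k - 2 * t k * inner (x (Suc k)) (x (Suc k) - z)
          + (\<theta> * \<epsilon> k * norm (x k))\<^sup>2 / (1 - \<theta> * L)"
        using energy_step[OF mono lip theta_pos theta_L(2) y_step x_step z]
        by (simp add: a_def t_def)
      have split: "inner (x (Suc k)) (x (Suc k) - z) = a (Suc k) + inner z (x (Suc k) - z)"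
        unfolding a_def power2_norm_eq_inner by (simp add: inner_diff_left)
      have "(\<theta> * \<epsilon> k * norm (x k))\<^sup>2 / (1 - \<theta> * L) \<le> 2 * t k * (c * \<epsilon> k)"
      proof -
        have "(\<theta> * \<epsilon> k * norm (x k))\<^sup>2 \<le> (\<theta> * \<epsilon> k * R)\<^sup>2"
          using R theta_pos eps_pos[of k] by (intro power_mono mult_left_mono) auto
        then have "(\<theta> * \<epsilon> k * norm (x k))\<^sup>2 / (1 - \<theta> * L) \<le> (\<theta> * \<epsilon> k * R)\<^sup>2 / (1 - \<theta> * L)"
          using theta_L by (simp add: divide_right_mono)
        also have "\<dots> = \<theta> * \<epsilon> k * (c * \<epsilon> k)" by (simp add: c_def power2_eq_square)
        also have "\<dots> \<le> 2 * t k * (c * \<epsilon> k)"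
          using elim theta_pos eps_pos[of k] c by (intro mult_right_mono) (auto simp: t_def)
        finally show ?thesis .
      qed
      with energy[unfolded split] have "a (Suc k)
          \<le> a k - 2 * t k * (a (Suc k) + inner z (x (Suc k) - z)) + 2 * t k * (c * \<epsilon> k)"
        by linarith
      then have "(1 + 2 * t k) * a (Suc k) \<le> a k + 2 * t k * s k"
        by (simp add: s_def algebra_simps)
      then have "a (Suc k) \<le> (a k + 2 * t k * s k) / (1 + 2 * t k)"
        using t[of k] by (simp add: field_simps)
      also have "\<dots> = (1 - b k) * a k + b k * s k"
        using t[of k] by (simp add: b_def divide_simps)
      finally show ?case .
    qed
  qed
  then have "(\<lambda>k. sqrt (a k)) \<longlonglongrightarrow> sqrt 0" by (intro tendsto_intros)
  then have "(\<lambda>k. norm (x k - z)) \<longlonglongrightarrow> 0" by (simp add: a_def)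
  then show ?thesis by (simp add: LIM_zero_iff tendsto_norm_zero_iff)
qed

lemma psi_bound:
  assumes \<delta>: "0 < \<delta>" "\<delta> < 1"
  shows "\<exists>C k0. C \<ge> 0 \<and> (\<forall>l\<ge>k0. gamma_factor \<delta> \<theta> \<epsilon> l \<noteq> 0) \<and>
    (\<forall>k\<ge>k0. psi M \<epsilon> x (Suc k) \<le>
       psi M \<epsilon> x k0 / gamma_seq \<delta> \<theta> \<epsilon> k0 k
       + C / gamma_seq \<delta> \<theta> \<epsilon> k0 k *
         (\<Sum>j=k0..k. gamma_seq \<delta> \<theta> \<epsilon> k0 j * \<epsilon> j *
            ((\<epsilon> (Suc j) - \<epsilon> j) / (\<theta> * \<epsilon> j))\<^sup>2))"
proof -
  obtain R where R: "\<And>k. norm (x k) \<le> R" using iterates_bounded by blast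
  define C where "C = \<theta> * R\<^sup>2 / (2 * \<delta>)"
  define r where "r k = \<epsilon> k * ((\<epsilon> (Suc k) - \<epsilon> k) / (\<theta> * \<epsilon> k))\<^sup>2" for k
  have "\<forall>\<^sub>F k in sequentially. \<epsilon> k \<le> 1 / (4 * \<theta>)"
    using theta_pos by (intro eventually_eps_le) simp
  then have "\<forall>\<^sub>F k in sequentially. gamma_factor \<delta> \<theta> \<epsilon> k > 0"
  proof eventually_elim
    case (elim k)
    then have "\<theta> * \<epsilon> k \<le> 1 / 4" using theta_pos by (simp add: field_simps)
    moreover have "(1 - \<delta>) * (\<theta> * \<epsilon> k) \<le> 1 * (\<theta> * \<epsilon> k)"
      using \<delta> theta_pos eps_pos[of k] by (intro mult_right_mono) auto
    ultimately show ?case unfolding gamma_factor_def mult.assoc by linarith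
  qed
  moreover note psi_recursion[OF R \<delta>, folded C_def r_def]
  ultimately obtain k0 where g: "\<And>l. l \<ge> k0 \<Longrightarrow> gamma_factor \<delta> \<theta> \<epsilon> l > 0"
    and rec: "\<And>k. k \<ge> k0 \<Longrightarrow>
      psi M \<epsilon> x (Suc k) \<le> gamma_factor \<delta> \<theta> \<epsilon> k * psi M \<epsilon> x k + C * r k"
    unfolding eventually_sequentially by (metis (no_types, lifting) le_cases order_trans)
  show ?thesis
  proof (intro exI conjI allI impI)
    show "C \<ge> 0" using theta_pos \<delta> by (simp add: C_def)
    show "gamma_factor \<delta> \<theta> \<epsilon> l \<noteq> 0" if "l \<ge> k0" for l using g[OF that] by simp
    fix k assume k: "k \<ge> k0"
    let ?G = "gamma_seq \<delta> \<theta> \<epsilon> k0"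
    have G: "?G k > 0" unfolding gamma_seq_def using g by (intro prod_pos) auto
    have "?G k * psi M \<epsilon> x (Suc k) \<le> psi M \<epsilon> x k0 + (\<Sum>j=k0..k. ?G j * (C * r j))"
      unfolding gamma_seq_def using g rec k by (rule linear_recursion_unrolled)
    also have "(\<Sum>j=k0..k. ?G j * (C * r j)) = C * (\<Sum>j=k0..k. ?G j * r j)"
      by (simp add: sum_distrib_left mult_ac)
    finally have "psi M \<epsilon> x (Suc k) \<le> (psi M \<epsilon> x k0 + C * (\<Sum>j=k0..k. ?G j * r j)) / ?G k"
      using G by (simp add: field_simps)
    then show "psi M \<epsilon> x (Suc k) \<le> psi M \<epsilon> x k0 / ?G k
       + C / ?G k * (\<Sum>j=k0..k. ?G j * \<epsilon> j * ((\<epsilon> (Suc j) - \<epsilon> j) / (\<theta> * \<epsilon> j))\<^sup>2)"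
      by (simp add: r_def add_divide_distrib mult.assoc)
  qed
qed

end

theorem theorem2p3:
  fixes M :: "'a::{real_inner, complete_space} \<Rightarrow> 'a"
    and L \<theta> :: real
    and \<epsilon> :: "nat \<Rightarrow> real"
    and x y :: "nat \<Rightarrow> 'a"
  assumes "L > 0"
    and "monotone_operator M"
    and "L-lipschitz_on UNIV M"
    and "zer M \<noteq> {}"
    and "0 < \<theta>" and "\<theta> < 1 / L"
    and "\<And>k. \<epsilon> k > 0"
    and "\<epsilon> \<longlonglongrightarrow> 0"
    and "filterlim (\<lambda>n. \<Sum>k\<le>n. \<epsilon> k) at_top sequentially"
    and "(\<lambda>k. \<bar>\<epsilon> (Suc k) - \<epsilon> k\<bar> / \<epsilon> k) \<longlonglongrightarrow> 0"
    and "\<And>k. y (Suc k) = x k - (\<theta> * \<epsilon> k) *\<^sub>R x k - \<theta> *\<^sub>R M (x k)"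
    and "\<And>k. x (Suc k) = x k - (\<theta> * \<epsilon> (Suc k)) *\<^sub>R x (Suc k) - \<theta> *\<^sub>R M (y (Suc k))"
  shows "(\<exists>!z. is_min_norm_element (zer M) z)
    \<and> x \<longlonglongrightarrow> min_norm_element (zer M)
    \<and> (\<forall>\<delta>. 0 < \<delta> \<and> \<delta> < 1 \<longrightarrow>
        (\<exists>C k0. C \<ge> 0 \<and> (\<forall>l\<ge>k0. gamma_factor \<delta> \<theta> \<epsilon> l \<noteq> 0) \<and>
          (\<forall>k\<ge>k0. psi M \<epsilon> x (Suc k) \<le>
             psi M \<epsilon> x k0 / gamma_seq \<delta> \<theta> \<epsilon> k0 k
             + C / gamma_seq \<delta> \<theta> \<epsilon> k0 k *
               (\<Sum>j=k0..k. gamma_seq \<delta> \<theta> \<epsilon> k0 j * \<epsilon> j *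
                  ((\<epsilon> (Suc j) - \<epsilon> j) / (\<theta> * \<epsilon> j))\<^sup>2))))"

proof -
  interpret tikhonov_extragradient M L \<theta> \<epsilon> x y
    using assms by unfold_locales
  obtain d zs z where d: "\<And>n. d n > 0" and zs: "\<And>n. M (zs n) + d n *\<^sub>R zs n = 0"
    and lim: "zs \<longlonglongrightarrow> z" and z: "M z = 0"
    using tikhonov_points_converge[OF mono lip zeros] by blast
  note avi = asymptotic_variational_inequality[OF mono d zs lim]
  have "inner z (w - z) \<ge> 0" if "M w = 0" for w
  proof (rule field_le_epsilon)
    fix r :: real assume "r > 0"
    have "\<forall>\<^sub>F k::nat in sequentially. - inner z (w - z) \<le> r"
      using avi[of "\<lambda>_. w" "norm w" r] that \<open>r > 0\<close> by simp
    then show "0 \<le> inner z (w - z) + r" by simp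
  qed
  with z have char: "is_min_norm_element (zer M) w \<longleftrightarrow> w = z" for w
    by (rule min_norm_zero_characterization)
  then have min: "min_norm_element (zer M) = z" by (simp add: min_norm_element_def)
  obtain R where R: "\<And>k. norm (x k) \<le> R" using iterates_bounded by blast
  have "x \<longlonglongrightarrow> z"
    using z avi[OF R residual_tendsto_zero] by (rule iterates_converge)
  moreover have "\<exists>!w. is_min_norm_element (zer M) w" by (simp add: char)
  ultimately show ?thesis unfolding min using psi_bound by blast
qed

end
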